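(* Let $\alpha\in(0,1)$, and consider a completely positive discretization $\mathcal{D}_\tau^\alpha$ with kernel $C=(c_{n-j}^n)$ on a grid $0=t_0<t_1<t_2<\cdots$. Suppose there is $\nu>0$ such that $c_{n-j}^n\ge \nu\frac{1}{\tau_j}\int_{t_{j-1}}^{t_j}g_{1-\alpha}(t_n-s)\,ds$ for all $1\le j\le n$ and all $n\ge1$. Let $\mu:=\nu\mu_1$, where $\mu_1\in(0,1)$ is the universal constant described in the context. Let $\lambda>0$ and assume $$\lambda\tau_n^\alpha<\min\big(\mu,\ \nu/\Gamma(2-\alpha)\big)\qquad\text{for all } n\ge1 .$$ Suppose a nonnegative sequence $(y_n)_{n\ge0}$ satisfies, for some constant $c$, $$\mathcal{D}_\tau^\alpha y_n\le\lambda y_n+c\qquad\text{for all } n\ge1 .$$ Then for all $n$ $$y_n\le\Big(y_0+\frac{c}{\lambda}\Big)E_\alpha(\mu^{-1}\lambda t_n^\alpha)-\frac{c}{\lambda} .$$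
   Context: $\tau_n:=t_n-t_{n-1}$ (no restriction on step ratios). $g_{1-\alpha}(t)=\frac{1}{\Gamma(1-\alpha)}t^{-\alpha}$ for $t>0$. $E_{\alpha,\beta}(z)=\sum_{k\ge0}\frac{z^k}{\Gamma(\alpha k+\beta)}$ and $E_\alpha=E_{\alpha,1}$ are Mittag-Leffler functions. A kernel is a lower triangular real array $C=(c_{n-j}^n)_{1\le j\le n}$, where $c_{n-j}^n$ is the entry in row $n$ and column $j$. The associated discrete fractional derivative of a real sequence $(u_n)_{n\ge 0}$ is $\mathcal{D}_\tau^\alpha u_n:=\sum_{j=1}^n c_{n-j}^n(u_j-u_{j-1})$, $n\ge1$. Put $b_0^n=c_0^n$ and $b_{n-j}^n=c_{n-j}^n-c_{n-j-1}^n$ for $1\le j\le n-1$. The discretization is called completely positive if for all $n\ge1$: $b_0^n>0$, $b_{n-j}^n\le 0$ for all $1\le j<n$, and $\sum_{j=1}^n b_{n-j}^n\ge 0$. The constant $\mu_1$: there exists a universal $\mu_1\in(0,1)$ (independent of all parameters) such that for all $\alpha\in(0,1)$, all $\kappa>0$ and all $0\le t<t+\tau\le T$ with $\kappa\tau^\alpha\le1$, setting $w(s)=\kappa s^{\alpha-1}E_{\alpha,\alpha}(\kappa s^\alpha)$, $$\frac1\tau\int_t^{t+\tau}(T-s)^{-\alpha}ds\int_t^{t+\tau}w(s)\,ds\ \ge\ \mu_1\int_t^{t+\tau}(T-s)^{-\alpha}w(s)\,ds .$$ Fix such a $\mu_1$.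
   Formalization: The formal theorem adds the condition y_0 + c/λ ≥ 0 (automatic when c ≥ 0); for arbitrary real c the printed claim is false, e.g. for the kernel c_{n-j}^n = M_j with M_j nondecreasing and M_1 large. *)

theory Defs
  imports "HOL-Analysis.Analysis"
begin

definition mittag_leffler :: "real \<Rightarrow> real \<Rightarrow> real \<Rightarrow> real" where
  "mittag_leffler \<alpha> \<beta> z = (\<Sum>k. z ^ k / Gamma (\<alpha> * real k + \<beta>))"

text \<open>
  The kernel \<open>g\<^sub>1\<^sub>-\<^sub>\<alpha>\<close>. Mathematically it is defined for \<open>t > 0\<close> only; here the value at 0 is 0,
  which does not affect the integrals below.
\<close>

definition frac_kernel :: "real \<Rightarrow> real \<Rightarrow> real" where
  "frac_kernel \<alpha> t = t powr (- \<alpha>) / Gamma (1 - \<alpha>)"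

text \<open>
  A grid is a sequence \<open>t :: nat \<Rightarrow> real\<close>; \<open>step t n\<close> is used for \<open>n \<ge> 1\<close> only.
\<close>

definition step :: "(nat \<Rightarrow> real) \<Rightarrow> nat \<Rightarrow> real" where
  "step t n = t n - t (n - 1)"

text \<open>
  A kernel is \<open>C :: nat \<Rightarrow> nat \<Rightarrow> real\<close>, where \<open>C n k\<close> is the coefficient with superscript \<open>n\<close> and
  subscript \<open>k\<close>. Thus \<open>C n (n - j)\<close> is the entry in row \<open>n\<close> and column \<open>j\<close>, and only the values
  with \<open>k < n\<close> are ever used.
\<close>

definition discrete_deriv :: "(nat \<Rightarrow> nat \<Rightarrow> real) \<Rightarrow> (nat \<Rightarrow> real) \<Rightarrow> nat \<Rightarrow> real" where
  "discrete_deriv C u n = (\<Sum>j = 1..n. C n (n - j) * (u j - u (j - 1)))"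

definition diff_kernel :: "(nat \<Rightarrow> nat \<Rightarrow> real) \<Rightarrow> nat \<Rightarrow> nat \<Rightarrow> real" where
  "diff_kernel C n k = (if k = 0 then C n 0 else C n k - C n (k - 1))"

definition completely_positive :: "(nat \<Rightarrow> nat \<Rightarrow> real) \<Rightarrow> bool" where
  "completely_positive C \<longleftrightarrow>
     (\<forall>n\<ge>1. diff_kernel C n 0 > 0
        \<and> (\<forall>j. 1 \<le> j \<and> j < n \<longrightarrow> diff_kernel C n (n - j) \<le> 0)
        \<and> (\<Sum>j = 1..n. diff_kernel C n (n - j)) \<ge> 0)"

definition ml_weight :: "real \<Rightarrow> real \<Rightarrow> real \<Rightarrow> real" where
  "ml_weight \<alpha> \<kappa> s = \<kappa> * s powr (\<alpha> - 1) * mittag_leffler \<alpha> \<alpha> (\<kappa> * s powr \<alpha>)"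

text \<open>
  Both integrands may be singular at an endpoint, where \<open>powr\<close> returns 0. They are nonnegative, so
  the Henstock--Kurzweil integral used here agrees with the (improper or Lebesgue) integral.
\<close>

definition universal_constant :: "real \<Rightarrow> bool" where
  "universal_constant \<mu>\<^sub>1 \<longleftrightarrow>
     0 < \<mu>\<^sub>1 \<and> \<mu>\<^sub>1 < 1 \<and>
     (\<forall>\<alpha> \<kappa> t \<tau> T. 0 < \<alpha> \<and> \<alpha> < 1 \<and> 0 < \<kappa> \<and> 0 \<le> t \<and> t < t + \<tau> \<and> t + \<tau> \<le> T
        \<and> \<kappa> * \<tau> powr \<alpha> \<le> 1 \<longrightarrow>
        1 / \<tau> * integral {t..t + \<tau>} (\<lambda>s. (T - s) powr (- \<alpha>))
              * integral {t..t + \<tau>} (ml_weight \<alpha> \<kappa>)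
        \<ge> \<mu>\<^sub>1 * integral {t..t + \<tau>} (\<lambda>s. (T - s) powr (- \<alpha>) * ml_weight \<alpha> \<kappa> s))"

end

theory Submission
  imports Defs "HOL-Real_Asymp.Real_Asymp"
begin

text \<open>
  With \<open>\<kappa> = \<lambda> / \<mu>\<close>, the function \<open>v(t) = E\<^sub>\<alpha>(\<kappa> t\<^sup>\<alpha>)\<close> has derivative \<open>ml_weight \<alpha> \<kappa>\<close> and solves the
  Caputo equation \<open>D\<^sup>\<alpha> v = \<kappa> v\<close>; both are verified termwise on the power series, the second one with
  Euler's Beta integral. The lower bound on the kernel and the Chebyshev-type inequality defining
  \<open>\<mu>\<^sub>1\<close>, applied on every grid cell, turn the equation into \<open>D v(t\<^sub>n) \<ge> \<mu> \<kappa> v(t\<^sub>n) = \<lambda> v(t\<^sub>n)\<close> for the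
  discrete derivative \<open>D\<close>. Hence \<open>(y\<^sub>0 + c/\<lambda>) v(t\<^sub>n) - c/\<lambda>\<close> is a supersolution with initial value
  \<open>y\<^sub>0\<close>, and a comparison principle applies because \<open>\<lambda> < c\<^sub>0\<^sup>n\<close> and the off-diagonal weights
  \<open>b\<close> are nonpositive.
\<close>

section \<open>Termwise integration of nonnegative series\<close>

lemma has_integral_sums_nonneg:
  fixes f :: "nat \<Rightarrow> real \<Rightarrow> real"
  assumes "\<And>k. (f k has_integral I k) S"
    and "\<And>k x. x \<in> S \<Longrightarrow> 0 \<le> f k x"
    and "\<And>x. x \<in> S \<Longrightarrow> (\<lambda>k. f k x) sums g x"
    and "I sums J"
  shows "(g has_integral J) S"
\<comment> \<open>Nonnegative terms make the partial sums increase, so monotone convergence applies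
  without any uniform bound on the series.\<close>
proof (rule has_integral_monotone_convergence_increasing)
  show "((\<lambda>x. \<Sum>k<n. f k x) has_integral (\<Sum>k<n. I k)) S" for n
    by (intro has_integral_sum assms(1)) auto
  show "(\<Sum>k<n. f k x) \<le> (\<Sum>k<Suc n. f k x)" if "x \<in> S" for n x
    using assms(2)[OF that] by simp
  show "(\<lambda>n. \<Sum>k<n. f k x) \<longlonglongrightarrow> g x" if "x \<in> S" for x
    using assms(3)[OF that] by (simp add: sums_def)
  show "(\<lambda>n. \<Sum>k<n. I k) \<longlonglongrightarrow> J"
    using assms(4) by (simp add: sums_def)
qed

section \<open>Gamma quotients and convergence of the Mittag-Leffler series\<close>

lemma Gamma_plus1_pos:
  fixes x :: real
  assumes "0 < x"
  shows "Gamma (x + 1) = x * Gamma x"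
  using assms by (intro Gamma_plus1) (auto elim!: nonpos_Ints_cases')

text \<open>Log-convexity of \<open>Gamma\<close> on the segment from \<open>x + \<alpha>\<close> to
  \<open>x + \<alpha> + 1\<close>, which contains \<open>x + 1\<close>, combined with the recurrence
  at both shifted points. The bound decays like \<open>x powr (- \<alpha>)\<close>, as the ratio
  test below requires.\<close>

lemma Gamma_ratio_le:
  fixes x \<alpha> :: real
  assumes "0 < x" "0 < \<alpha>" "\<alpha> < 1"
  shows "Gamma x / Gamma (x + \<alpha>) \<le> (x + \<alpha>) powr (1 - \<alpha>) / x"
proof -
  have pos: "0 < x + \<alpha>" "0 < Gamma x" "0 < Gamma (x + \<alpha>)" "0 < Gamma (x + \<alpha> + 1)" "0 < Gamma (x + 1)"
    using assms by auto
  have G: "Gamma (x + 1) = x * Gamma x" "Gamma (x + \<alpha> + 1) = (x + \<alpha>) * Gamma (x + \<alpha>)"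
    using assms pos by (simp_all only: Gamma_plus1_pos)
  have lnG: "ln ((x + \<alpha>) * Gamma (x + \<alpha>)) = ln (x + \<alpha>) + ln (Gamma (x + \<alpha>))"
    using pos by (intro ln_mult_pos)
  have "x + 1 = (1 - (1 - \<alpha>)) *\<^sub>R (x + \<alpha>) + (1 - \<alpha>) *\<^sub>R (x + \<alpha> + 1)"
    by (simp add: algebra_simps)
  with convex_onD[OF log_convex_Gamma_real, of "1 - \<alpha>" "x + \<alpha>" "x + \<alpha> + 1"] assms
  have "ln (Gamma (x + 1)) \<le> \<alpha> * ln (Gamma (x + \<alpha>)) + (1 - \<alpha>) * ln (Gamma (x + \<alpha> + 1))"
    by simp
  also have "\<dots> = ln (Gamma (x + \<alpha>)) + (1 - \<alpha>) * ln (x + \<alpha>)"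
    unfolding G lnG by (simp add: algebra_simps)
  also have "\<dots> = ln (Gamma (x + \<alpha>) * (x + \<alpha>) powr (1 - \<alpha>))"
    using pos by (subst ln_mult_pos) (auto simp: ln_powr simp del: Gamma_real_pos)
  finally have "Gamma (x + 1) \<le> Gamma (x + \<alpha>) * (x + \<alpha>) powr (1 - \<alpha>)"
    using pos by (subst (asm) ln_le_cancel_iff) auto
  then show ?thesis
    unfolding G using pos assms by (simp add: field_simps)
qed

text \<open>Consecutive terms have ratio \<open>|z| * Gamma x / Gamma (x + \<alpha>)\<close> in
  absolute value, with \<open>x = \<alpha> * k + \<beta>\<close>. This tends to 0, so the ratio test
  applies for every real \<open>z\<close>.\<close>

lemma mittag_leffler_sums:
  fixes \<alpha> \<beta> z :: real
  assumes "0 < \<alpha>" "\<alpha> < 1" "0 < \<beta>"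
  shows "(\<lambda>k. z ^ k / Gamma (\<alpha> * real k + \<beta>)) sums mittag_leffler \<alpha> \<beta> z"
proof -
  let ?x = "\<lambda>k. \<alpha> * real k + \<beta>"
  have "((\<lambda>x. \<bar>z\<bar> * ((x + \<alpha>) powr (1 - \<alpha>) / x)) \<longlongrightarrow> 0) at_top"
    using assms by real_asymp
  moreover have "filterlim ?x at_top sequentially"
    using assms by real_asymp
  ultimately have "(\<lambda>k. \<bar>z\<bar> * ((?x k + \<alpha>) powr (1 - \<alpha>) / ?x k)) \<longlonglongrightarrow> 0"
    by (rule filterlim_compose)
  then have "eventually (\<lambda>k. \<bar>z\<bar> * ((?x k + \<alpha>) powr (1 - \<alpha>) / ?x k) < 1 / 2) sequentially"
    by (rule order_tendstoD) simp
  then obtain N where N: "\<And>k. k \<ge> N \<Longrightarrow> \<bar>z\<bar> * ((?x k + \<alpha>) powr (1 - \<alpha>) / ?x k) < 1 / 2"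
    by (auto simp: eventually_sequentially)
  have "summable (\<lambda>k. z ^ k / Gamma (?x k))"
  proof (rule summable_ratio_test[of "1 / 2" N])
    fix k assume "N \<le> k"
    have x: "0 < ?x k" and x': "0 < ?x k + \<alpha>" using assms by (auto intro: add_nonneg_pos add_pos_pos)
    have eq: "?x (Suc k) = ?x k + \<alpha>" by (simp add: algebra_simps)
    have "\<bar>z\<bar> * (Gamma (?x k) / Gamma (?x k + \<alpha>)) \<le> \<bar>z\<bar> * ((?x k + \<alpha>) powr (1 - \<alpha>) / ?x k)"
      using assms x by (intro mult_left_mono Gamma_ratio_le) auto
    also have "\<dots> \<le> 1 / 2" using N[OF \<open>N \<le> k\<close>] by simp
    finally have le: "\<bar>z\<bar> * (Gamma (?x k) / Gamma (?x k + \<alpha>)) \<le> 1 / 2" .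
    have "norm (z ^ Suc k / Gamma (?x (Suc k)))
        = \<bar>z\<bar> * (Gamma (?x k) / Gamma (?x k + \<alpha>)) * (\<bar>z\<bar> ^ k / Gamma (?x k))"
      unfolding eq using Gamma_real_pos[OF x] Gamma_real_pos[OF x']
      by (simp add: power_abs abs_mult)
    also have "\<dots> \<le> 1 / 2 * (\<bar>z\<bar> ^ k / Gamma (?x k))"
      using le Gamma_real_pos[OF x] by (intro mult_right_mono) auto
    also have "\<dots> = 1 / 2 * norm (z ^ k / Gamma (?x k))"
      using Gamma_real_pos[OF x] by (simp add: power_abs)
    finally show "norm (z ^ Suc k / Gamma (?x (Suc k))) \<le> 1 / 2 * norm (z ^ k / Gamma (?x k))" .
  qed simp
  then show ?thesis
    unfolding mittag_leffler_def by (rule summable_sums)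
qed

lemma mittag_leffler_one_zero:
  "mittag_leffler \<alpha> 1 0 = 1"
proof -
  have "(\<lambda>k. 0 ^ k / Gamma (\<alpha> * real k + 1)) = (\<lambda>k. inverse (Gamma (\<alpha> * real k + 1)) * 0 ^ k)"
    by (simp add: divide_inverse mult.commute)
  then show ?thesis
    unfolding mittag_leffler_def by (simp add: powser_zero)
qed

section \<open>Power integrals and the rescaled Beta integral\<close>

lemma has_integral_powr_diff:
  fixes a b p :: real
  assumes "0 \<le> a" "a \<le> b" "0 < p"
  shows "((\<lambda>s. s powr (p - 1)) has_integral (b powr p - a powr p) / p) {a..b}"
proof -
  have "((\<lambda>s. s powr (p - 1)) has_integral (b powr p / p - a powr p / p)) {a..b}"
  \<comment> \<open>For \<open>a = 0\<close> and \<open>p < 1\<close> the integrand is singular at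
    0; the interior version asks only for continuity of the antiderivative there.\<close>
  proof (rule fundamental_theorem_of_calculus_interior)
    show "continuous_on {a..b} (\<lambda>s. s powr p / p)"
      using assms by (intro continuous_intros continuous_on_powr') auto
    show "((\<lambda>s. s powr p / p) has_vector_derivative s powr (p - 1)) (at s)" if "s \<in> {a<..<b}" for s
      using that assms unfolding has_real_derivative_iff_has_vector_derivative[symmetric]
      by (auto intro!: derivative_eq_intros simp: powr_diff)
  qed fact
  then show ?thesis by (simp add: diff_divide_distrib)
qed

lemma has_integral_Beta_scaled:
  fixes a b T :: real
  assumes "0 < a" "0 < b" "0 < T"
  shows "((\<lambda>s. s powr (a - 1) * (T - s) powr (b - 1)) has_integral T powr (a + b - 1) * Beta a b) {0..T}"
proof -
  let ?f = "\<lambda>u. u powr (a - 1) * (1 - u) powr (b - 1)"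
  have "(\<lambda>u. u / (1 / T)) ` {0..1} = {0..T}"
    using assms image_mult_atLeastAtMost[of T 0 1] by (simp add: mult.commute)
  with has_integral_stretch_real[OF has_integral_Beta_real[OF assms(1,2)], of "1 / T"] assms
  have "((\<lambda>s. ?f (1 / T * s)) has_integral T * Beta a b) {0..T}"
    by simp
  \<comment> \<open>The substitution \<open>s = T * u\<close> leaves \<open>s / T\<close> and
    \<open>1 - s / T\<close> as bases; this constant restores \<open>s\<close> and
    \<open>T - s\<close>.\<close>
  then have "((\<lambda>s. T powr (a + b - 2) * ?f (1 / T * s)) has_integral
      T powr (a + b - 2) * (T * Beta a b)) {0..T}"
    by (rule has_integral_mult_right)
  moreover have "T powr (a + b - 2) * (T * Beta a b) = T powr (a + b - 1) * Beta a b"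
    using assms powr_add[of T "a + b - 2" 1] by (simp add: algebra_simps)
  moreover have eq: "T powr (a + b - 2) * ?f (1 / T * s) = s powr (a - 1) * (T - s) powr (b - 1)"
    if "s \<in> {0..T}" for s
  proof -
    have "1 - s / T = (T - s) / T" using assms by (simp add: field_simps)
    moreover have "T powr (a + b - 2) = T powr (a - 1) * T powr (b - 1)"
      by (simp flip: powr_add)
    ultimately show ?thesis
      using that assms by (simp add: powr_divide)
  qed
  ultimately show ?thesis
    by (subst has_integral_cong[OF eq[symmetric]]) simp_all
qed

section \<open>The Mittag-Leffler weight and the Caputo equation\<close>

lemma ml_weight_sums:
  assumes "0 < \<alpha>" "\<alpha> < 1" "0 \<le> s"
  shows "(\<lambda>k. \<kappa> ^ Suc k / Gamma (\<alpha> * real k + \<alpha>) * s powr (\<alpha> * real k + \<alpha> - 1)) sums ml_weight \<alpha> \<kappa> s"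
proof -
  \<comment> \<open>At \<open>s = 0\<close> both sides vanish, since \<open>0 powr x = 0\<close> for
    every exponent; the expansion therefore includes the endpoint.\<close>
  have e: "s powr (\<alpha> * real k + \<alpha> - 1) = s powr (\<alpha> - 1) * (s powr \<alpha>) ^ k" for k
  proof (cases "s = 0")
    case False
    have "s powr (\<alpha> * real k + \<alpha> - 1) = s powr (\<alpha> - 1) * s powr (\<alpha> * real k)"
      by (simp flip: powr_add add: algebra_simps)
    then show ?thesis using False by (simp add: powr_power mult.commute)
  qed simp
  have eq: "\<kappa> * s powr (\<alpha> - 1) * ((\<kappa> * s powr \<alpha>) ^ k / Gamma (\<alpha> * real k + \<alpha>))
      = \<kappa> ^ Suc k / Gamma (\<alpha> * real k + \<alpha>) * s powr (\<alpha> * real k + \<alpha> - 1)" for k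
    unfolding e by (simp add: power_mult_distrib)
  then show ?thesis
    unfolding ml_weight_def
    using sums_mult[OF mittag_leffler_sums[of \<alpha> \<alpha> "\<kappa> * s powr \<alpha>"], of "\<kappa> * s powr (\<alpha> - 1)"] assms
    by (simp only: eq)
qed

lemma ml_weight_coeff_nonneg:
  assumes "0 < \<alpha>" "0 < \<kappa>"
  shows "0 \<le> \<kappa> ^ Suc k / Gamma (\<alpha> * real k + \<alpha>)"
  using assms by (auto intro!: divide_nonneg_nonneg Gamma_real_nonneg add_nonneg_pos)

lemma ml_weight_nonneg:
  assumes "0 < \<alpha>" "\<alpha> < 1" "0 < \<kappa>" "0 \<le> s"
  shows "0 \<le> ml_weight \<alpha> \<kappa> s"
proof (rule sums_le[OF _ sums_zero ml_weight_sums[OF assms(1,2,4)]])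
  show "0 \<le> \<kappa> ^ Suc k / Gamma (\<alpha> * real k + \<alpha>) * s powr (\<alpha> * real k + \<alpha> - 1)" for k
    using assms by (intro mult_nonneg_nonneg ml_weight_coeff_nonneg) auto
qed

text \<open>Integrating term \<open>k\<close> of the weight yields term \<open>k + 1\<close> of the
  Mittag-Leffler series, because \<open>Gamma (p + 1) = p * Gamma p\<close> at
  \<open>p = \<alpha> * k + \<alpha>\<close>.\<close>

lemma has_integral_ml_weight:
  assumes "0 < \<alpha>" "\<alpha> < 1" "0 < \<kappa>" "0 \<le> a" "a \<le> b"
  shows "(ml_weight \<alpha> \<kappa> has_integral
    mittag_leffler \<alpha> 1 (\<kappa> * b powr \<alpha>) - mittag_leffler \<alpha> 1 (\<kappa> * a powr \<alpha>)) {a..b}"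
proof (rule has_integral_sums_nonneg)
  let ?c = "\<lambda>k. \<kappa> ^ Suc k / Gamma (\<alpha> * real k + \<alpha>)"
  let ?p = "\<lambda>k. \<alpha> * real k + \<alpha>"
  have p: "0 < ?p k" for k using assms by (auto intro: add_nonneg_pos)
  show "((\<lambda>s. ?c k * s powr (?p k - 1)) has_integral ?c k * ((b powr ?p k - a powr ?p k) / ?p k)) {a..b}" for k
    using assms p by (intro has_integral_mult_right has_integral_powr_diff) auto
  show "0 \<le> ?c k * s powr (?p k - 1)" if "s \<in> {a..b}" for k s
    using assms by (intro mult_nonneg_nonneg ml_weight_coeff_nonneg) auto
  show "(\<lambda>k. ?c k * s powr (?p k - 1)) sums ml_weight \<alpha> \<kappa> s" if "s \<in> {a..b}" for s
    using that assms ml_weight_sums by auto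
  have "(\<lambda>k. (\<kappa> * b powr \<alpha>) ^ k / Gamma (\<alpha> * real k + 1) - (\<kappa> * a powr \<alpha>) ^ k / Gamma (\<alpha> * real k + 1))
      sums (mittag_leffler \<alpha> 1 (\<kappa> * b powr \<alpha>) - mittag_leffler \<alpha> 1 (\<kappa> * a powr \<alpha>))"
    using assms by (intro sums_diff mittag_leffler_sums) auto
  \<comment> \<open>The terms of index 0 are the same at both endpoints and cancel, so the series
    may start at index 1.\<close>
  then have "(\<lambda>k. (\<kappa> * b powr \<alpha>) ^ Suc k / Gamma (\<alpha> * real (Suc k) + 1) - (\<kappa> * a powr \<alpha>) ^ Suc k / Gamma (\<alpha> * real (Suc k) + 1))
      sums (mittag_leffler \<alpha> 1 (\<kappa> * b powr \<alpha>) - mittag_leffler \<alpha> 1 (\<kappa> * a powr \<alpha>))"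
    by (subst sums_Suc_iff) simp
  moreover have "(\<kappa> * b powr \<alpha>) ^ Suc k / Gamma (\<alpha> * real (Suc k) + 1) - (\<kappa> * a powr \<alpha>) ^ Suc k / Gamma (\<alpha> * real (Suc k) + 1)
      = ?c k * ((b powr ?p k - a powr ?p k) / ?p k)" for k
  proof -
    have e: "(s powr \<alpha>) ^ Suc k = s powr ?p k" if "0 \<le> s" for s
      using that by (cases "s = 0") (simp_all add: powr_power algebra_simps del: power_Suc)
    have "Gamma (\<alpha> * real (Suc k) + 1) = ?p k * Gamma (?p k)"
      using Gamma_plus1_pos[OF p[of k]] by (simp add: algebra_simps)
    then show ?thesis
      using assms e[of a] e[of b]
      by (simp add: power_mult_distrib diff_divide_distrib right_diff_distrib mult_ac del: power_Suc)
  qed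
  ultimately show "(\<lambda>k. ?c k * ((b powr ?p k - a powr ?p k) / ?p k))
      sums (mittag_leffler \<alpha> 1 (\<kappa> * b powr \<alpha>) - mittag_leffler \<alpha> 1 (\<kappa> * a powr \<alpha>))"
    by simp
qed

text \<open>With \<open>p = \<alpha> * k + \<alpha>\<close>, \<open>Beta p (1 - \<alpha>)\<close>
  equals \<open>Gamma p * Gamma (1 - \<alpha>) / Gamma (\<alpha> * k + 1)\<close>. The factor
  \<open>Gamma p\<close> cancels the weight's denominator, and the Mittag-Leffler series with second
  parameter 1 reappears.\<close>

lemma has_integral_caputo_mittag_leffler:
  assumes "0 < \<alpha>" "\<alpha> < 1" "0 < \<kappa>" "0 < T"
  shows "((\<lambda>s. (T - s) powr (- \<alpha>) * ml_weight \<alpha> \<kappa> s) has_integral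
    Gamma (1 - \<alpha>) * \<kappa> * mittag_leffler \<alpha> 1 (\<kappa> * T powr \<alpha>)) {0..T}"
proof (rule has_integral_sums_nonneg)
  let ?c = "\<lambda>k. \<kappa> ^ Suc k / Gamma (\<alpha> * real k + \<alpha>)"
  let ?p = "\<lambda>k. \<alpha> * real k + \<alpha>"
  let ?f = "\<lambda>k s. ?c k * (s powr (?p k - 1) * (T - s) powr (1 - \<alpha> - 1))"
  let ?I = "\<lambda>k. ?c k * (T powr (?p k + (1 - \<alpha>) - 1) * Beta (?p k) (1 - \<alpha>))"
  have p: "0 < ?p k" for k using assms by (auto intro: add_nonneg_pos)
  show "(?f k has_integral ?I k) {0..T}" for k
    using assms p by (intro has_integral_mult_right has_integral_Beta_scaled) auto
  show "0 \<le> ?f k s" for k s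
    using assms by (intro mult_nonneg_nonneg ml_weight_coeff_nonneg) auto
  show "(\<lambda>k. ?f k s) sums ((T - s) powr (- \<alpha>) * ml_weight \<alpha> \<kappa> s)" if "s \<in> {0..T}" for s
    using sums_mult[OF ml_weight_sums[of \<alpha> s \<kappa>], of "(T - s) powr (- \<alpha>)"] that assms
    by (simp add: mult_ac)
  have "(\<lambda>k. Gamma (1 - \<alpha>) * \<kappa> * ((\<kappa> * T powr \<alpha>) ^ k / Gamma (\<alpha> * real k + 1)))
      sums (Gamma (1 - \<alpha>) * \<kappa> * mittag_leffler \<alpha> 1 (\<kappa> * T powr \<alpha>))"
    using assms by (intro sums_mult mittag_leffler_sums) auto
  moreover have "Gamma (1 - \<alpha>) * \<kappa> * ((\<kappa> * T powr \<alpha>) ^ k / Gamma (\<alpha> * real k + 1)) = ?I k" for k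
    using assms Gamma_real_pos[OF p[of k]]
    by (simp add: Beta_def power_mult_distrib powr_power mult_ac)
  ultimately show "?I sums (Gamma (1 - \<alpha>) * \<kappa> * mittag_leffler \<alpha> 1 (\<kappa> * T powr \<alpha>))"
    by simp
qed

section \<open>Grid sums and the discrete comparison principle\<close>

lemma sum_integral_telescope:
  fixes f :: "real \<Rightarrow> real" and t :: "nat \<Rightarrow> real"
  assumes "mono t" "f integrable_on {t 0..t n}"
  shows "(\<Sum>j = 1..n. integral {t (j - 1)..t j} f) = integral {t 0..t n} f"
  using assms(2)
proof (induction n)
  case (Suc n)
  have le: "t 0 \<le> t n" "t n \<le> t (Suc n)" using assms(1) by (auto intro: monoD)
  then have "f integrable_on {t 0..t n}"
    using Suc.prems by (auto intro: integrable_subinterval_real)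
  then show ?case
    using Suc.IH Suc.prems le Henstock_Kurzweil_Integration.integral_combine[of "t 0" "t n" "t (Suc n)" f] by simp
qed simp

text \<open>Summation by parts: collecting the coefficient of each \<open>u j\<close> exposes the
  weights whose signs complete positivity controls.\<close>

lemma discrete_deriv_eq_diff_kernel:
  assumes "u 0 = 0" "1 \<le> n"
  shows "discrete_deriv C u n = (\<Sum>j = 1..n. diff_kernel C n (n - j) * u j)"
proof -
  \<comment> \<open>Stopping at \<open>m < n\<close> leaves a boundary term, which the next
    difference absorbs. It vanishes at \<open>m = 0\<close> by \<open>u 0 = 0\<close> and is absent
    at \<open>m = n\<close>.\<close>
  have *: "m \<le> n \<Longrightarrow> (\<Sum>j = 1..m. C n (n - j) * (u j - u (j - 1)))
      = (\<Sum>j = 1..m. diff_kernel C n (n - j) * u j) + (if m < n then C n (n - Suc m) * u m else 0)" for m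
  proof (induction m)
    case 0
    then show ?case using assms by simp
  next
    case (Suc m)
    have "n - m = Suc (n - Suc m)" using Suc.prems by simp
    then show ?case
      using Suc by (cases "Suc m < n") (auto simp: diff_kernel_def algebra_simps Suc_diff_Suc)
  qed
  show ?thesis
    unfolding discrete_deriv_def using *[of n] by simp
qed

lemma discrete_comparison:
  assumes cp: "completely_positive C"
    and "\<And>n. 1 \<le> n \<Longrightarrow> lam < C n 0"
    and "e 0 = 0"
    and "\<And>n. 1 \<le> n \<Longrightarrow> discrete_deriv C e n \<le> lam * e n"
  shows "e n \<le> 0"
proof (induction n rule: less_induct)
  case (less n)
  show ?case
  proof (cases "n = 0")
    case False
    then have n: "1 \<le> n" by simp
    have "{1..n} = insert n {1..<n}" using n by auto
    then have "discrete_deriv C e n = C n 0 * e n + (\<Sum>j = 1..<n. diff_kernel C n (n - j) * e j)"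
      using discrete_deriv_eq_diff_kernel[of e n C] assms(3) n by (simp add: diff_kernel_def)
    moreover have "0 \<le> (\<Sum>j = 1..<n. diff_kernel C n (n - j) * e j)"
      using cp less n unfolding completely_positive_def
      by (intro sum_nonneg mult_nonpos_nonpos) auto
    ultimately have "(C n 0 - lam) * e n \<le> 0"
      using assms(4)[OF n] by (simp add: algebra_simps)
    then show ?thesis
      using assms(2)[OF n] by (simp add: mult_le_0_iff)
  qed (use assms(3) in simp)
qed

text \<open>Serves the last cell of each row, which ends at the kernel's singularity, to bound the
  diagonal coefficient from below.\<close>

lemma has_integral_reflected_powr:
  fixes a T \<alpha> :: real
  assumes "a \<le> T" "\<alpha> < 1"
  shows "((\<lambda>s. (T - s) powr (- \<alpha>)) has_integral (T - a) powr (1 - \<alpha>) / (1 - \<alpha>)) {a..T}"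
proof -
  let ?F = "\<lambda>s. (T - s) powr (1 - \<alpha>) / - (1 - \<alpha>)"
  have "(?F has_real_derivative (T - s) powr (- \<alpha>)) (at s)" if "s \<in> {a<..<T}" for s
  proof -
    have "((\<lambda>s. (T - s) powr (1 - \<alpha>)) has_real_derivative
        (1 - \<alpha>) * (T - s) powr (1 - \<alpha> - 1) * (0 - 1)) (at s)"
      using that by (intro DERIV_chain2[OF has_real_derivative_powr] derivative_intros) auto
    moreover have "(1 - \<alpha>) * (T - s) powr (1 - \<alpha> - 1) * (0 - 1) / - (1 - \<alpha>) = (T - s) powr (- \<alpha>)"
      using assms by (simp add: divide_simps) (simp add: algebra_simps)
    ultimately show ?thesis
      by (metis DERIV_cdivide)
  qed
  moreover have "continuous_on {a..T} ?F"
    using assms by (intro continuous_intros continuous_on_powr') auto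
  ultimately have "((\<lambda>s. (T - s) powr (- \<alpha>)) has_integral ?F T - ?F a) {a..T}"
    using assms(1)
    by (intro fundamental_theorem_of_calculus_interior)
       (auto simp flip: has_real_derivative_iff_has_vector_derivative)
  then show ?thesis
    using assms minus_divide_right[of "(T - a) powr (1 - \<alpha>)" "\<alpha> - 1"] by simp
qed

theorem theorem4p3:
  fixes \<alpha> \<nu> \<mu>\<^sub>1 \<mu> lam c :: real
    and t y :: "nat \<Rightarrow> real"
    and C :: "nat \<Rightarrow> nat \<Rightarrow> real"
  assumes "0 < \<alpha>" and "\<alpha> < 1"
    and "t 0 = 0" and "strict_mono t"
    and "completely_positive C"
    and "\<nu> > 0"
    and "\<And>n j. 1 \<le> j \<Longrightarrow> j \<le> n \<Longrightarrow>
           C n (n - j) \<ge> \<nu> * (1 / step t j *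
             integral {t (j - 1)..t j} (\<lambda>s. frac_kernel \<alpha> (t n - s)))"
    and "universal_constant \<mu>\<^sub>1" and "\<mu> = \<nu> * \<mu>\<^sub>1"
    and "lam > 0"
    and "\<And>n. 1 \<le> n \<Longrightarrow> lam * step t n powr \<alpha> < min \<mu> (\<nu> / Gamma (2 - \<alpha>))"
    and "\<And>n. 0 \<le> y n"
    and "\<And>n. 1 \<le> n \<Longrightarrow> discrete_deriv C y n \<le> lam * y n + c"
    and "0 \<le> y 0 + c / lam"
  shows "\<forall>n. y n \<le> (y 0 + c / lam) * mittag_leffler \<alpha> 1 (inverse \<mu> * lam * t n powr \<alpha>) - c / lam"
proof
  fix n
  \<comment> \<open>Chosen so that \<open>\<mu> * \<kappa> = lam\<close>: the factor
    \<open>\<mu>\<close> lost in discretizing is exactly compensated.\<close>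
  define \<kappa> where "\<kappa> = inverse \<mu> * lam"
  define v where "v = (\<lambda>n. mittag_leffler \<alpha> 1 (\<kappa> * t n powr \<alpha>))"
  define A where "A = y 0 + c / lam"
  \<comment> \<open>The shift by \<open>c / lam\<close> absorbs the inhomogeneity \<open>c\<close>:
    differences do not see it, while \<open>lam * (c / lam) = c\<close>.\<close>
  define e where "e = (\<lambda>n. y n - (A * v n - c / lam))"
  have \<mu>\<^sub>1: "0 < \<mu>\<^sub>1"
    using assms(8) by (simp add: universal_constant_def)
  then have \<mu>: "0 < \<mu>"
    using assms(6,9) by simp
  then have \<kappa>: "0 < \<kappa>" and \<kappa>\<mu>: "\<mu> * \<kappa> = lam"
    using assms(10) by (simp_all add: \<kappa>_def)
  have t_less: "t (j - 1) < t j" if "1 \<le> j" for j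
    using that assms(4) by (auto simp: strict_mono_def)
  have t_nonneg: "0 \<le> t j" for j
    using assms(3,4) strict_mono_mono[of t] by (metis monoD le0)
  have t_mono: "t i \<le> t j" if "i \<le> j" for i j
    using that assms(4) strict_mono_mono[of t] by (auto dest: monoD)
  have step_pos: "0 < step t j" if "1 \<le> j" for j
    using t_less[OF that] by (simp add: step_def)
  have frac_int: "integral S (\<lambda>s. frac_kernel \<alpha> (T - s))
      = integral S (\<lambda>s. (T - s) powr (- \<alpha>)) / Gamma (1 - \<alpha>)" for S T
    by (simp add: frac_kernel_def)
  have G: "0 < Gamma (1 - \<alpha>)"
    using assms(2) by simp

  \<comment> \<open>The sampled Mittag-Leffler function as a discrete supersolution\<close>
  have v_ge: "lam * v n \<le> discrete_deriv C v n" if n: "1 \<le> n" for n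
  proof -
    let ?h = "\<lambda>s. (t n - s) powr (- \<alpha>) * ml_weight \<alpha> \<kappa> s"
    have T: "0 < t n"
      using t_less[OF n] t_nonneg[of "n - 1"] by simp
    have h: "(?h has_integral Gamma (1 - \<alpha>) * \<kappa> * v n) {0..t n}"
      unfolding v_def by (rule has_integral_caputo_mittag_leffler) (use assms(1,2) \<kappa> T in auto)
    have "\<mu> / Gamma (1 - \<alpha>) * integral {t (j - 1)..t j} ?h \<le> C n (n - j) * (v j - v (j - 1))"
      if j: "1 \<le> j" "j \<le> n" for j
    proof -
      have w: "(ml_weight \<alpha> \<kappa> has_integral v j - v (j - 1)) {t (j - 1)..t j}"
        unfolding v_def
        by (rule has_integral_ml_weight) (use assms(1,2) \<kappa> t_nonneg t_less[OF j(1)] in auto)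
      then have W: "integral {t (j - 1)..t j} (ml_weight \<alpha> \<kappa>) = v j - v (j - 1)"
        by (rule integral_unique)
      \<comment> \<open>Monotonicity of \<open>v\<close> lets the lower bound on
        \<open>C n (n - j)\<close> be multiplied by this increment.\<close>
      have v: "0 \<le> v j - v (j - 1)"
        using ml_weight_nonneg[OF assms(1,2) \<kappa>] t_nonneg[of "j - 1"]
        by (intro has_integral_nonneg[OF w]) auto
      have tj: "t (j - 1) + step t j = t j" by (simp add: step_def)
      \<comment> \<open>The first entry of the \<open>min\<close> in the step-size condition
        supplies the smallness condition in \<open>universal_constant\<close>.\<close>
      have "\<mu> * (\<kappa> * step t j powr \<alpha>) \<le> \<mu> * 1"
        using assms(11)[OF j(1)] \<kappa>\<mu> by (simp add: mult.assoc[symmetric])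
      then have "\<kappa> * step t j powr \<alpha> \<le> 1"
        using \<mu> by (simp only: mult_le_cancel_left_pos)
      then have "\<mu>\<^sub>1 * integral {t (j - 1)..t (j - 1) + step t j} ?h
          \<le> 1 / step t j * integral {t (j - 1)..t (j - 1) + step t j} (\<lambda>s. (t n - s) powr (- \<alpha>))
            * integral {t (j - 1)..t (j - 1) + step t j} (ml_weight \<alpha> \<kappa>)"
        using assms(1,2) \<kappa> t_nonneg[of "j - 1"] t_less[OF j(1)] t_mono[OF j(2)]
          assms(8)[unfolded universal_constant_def, THEN conjunct2, THEN conjunct2,
            THEN spec, THEN spec, THEN spec, THEN spec, THEN spec,
            of \<alpha> \<kappa> "t (j - 1)" "step t j" "t n"]
        unfolding tj by (simp only: simp_thms)
      then have "\<nu> / Gamma (1 - \<alpha>) * (\<mu>\<^sub>1 * integral {t (j - 1)..t j} ?h)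
          \<le> \<nu> / Gamma (1 - \<alpha>) * (1 / step t j * integral {t (j - 1)..t j} (\<lambda>s. (t n - s) powr (- \<alpha>))
            * (v j - v (j - 1)))"
        unfolding tj W using assms(6) G by (intro mult_left_mono) auto
      also have "\<dots> = \<nu> * (1 / step t j * integral {t (j - 1)..t j} (\<lambda>s. frac_kernel \<alpha> (t n - s)))
            * (v j - v (j - 1))"
        unfolding frac_int by (simp add: mult_ac)
      also have "\<dots> \<le> C n (n - j) * (v j - v (j - 1))"
        using assms(7)[OF j] v by (rule mult_right_mono)
      finally show ?thesis by (simp add: assms(9))
    qed
    then have "(\<Sum>j = 1..n. \<mu> / Gamma (1 - \<alpha>) * integral {t (j - 1)..t j} ?h) \<le> discrete_deriv C v n"
      unfolding discrete_deriv_def by (intro sum_mono) auto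
    \<comment> \<open>The cell integrals add up to the full convolution on \<open>{0..t n}\<close>,
      whose value the Caputo identity \<open>h\<close> provides.\<close>
    also have "(\<Sum>j = 1..n. \<mu> / Gamma (1 - \<alpha>) * integral {t (j - 1)..t j} ?h)
        = \<mu> / Gamma (1 - \<alpha>) * integral {t 0..t n} ?h"
      using h assms(3,4) strict_mono_mono
      by (subst sum_integral_telescope[symmetric]) (auto simp: sum_distrib_left integrable_on_def)
    also have "\<dots> = lam * v n"
      using h G assms(3) \<kappa>\<mu> by (simp add: integral_unique)
    finally show ?thesis .
  qed

  \<comment> \<open>Comparison of \<open>y\<close> with the supersolution\<close>
  have "e n \<le> 0"
  proof (rule discrete_comparison[OF assms(5), where lam = lam])
    show "e 0 = 0"
      using mittag_leffler_one_zero assms(3) by (simp add: e_def v_def A_def)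
    fix m :: nat assume m: "1 \<le> m"
    \<comment> \<open>The kernel average over the last cell is
      \<open>step t m powr (- \<alpha>) / Gamma (2 - \<alpha>)\<close>; by the second entry of the
      \<open>min\<close>, \<open>\<nu>\<close> times it exceeds \<open>lam\<close>.\<close>
    have I: "integral {t (m - 1)..t m} (\<lambda>s. (t m - s) powr (- \<alpha>)) = step t m powr (1 - \<alpha>) / (1 - \<alpha>)"
      unfolding step_def using t_less[OF m] assms(2)
      by (intro integral_unique has_integral_reflected_powr) auto
    have "Gamma (2 - \<alpha>) = (1 - \<alpha>) * Gamma (1 - \<alpha>)"
      using Gamma_plus1_pos[of "1 - \<alpha>"] assms(2) by simp
    then have "1 / step t m * (step t m powr (1 - \<alpha>) / (1 - \<alpha>) / Gamma (1 - \<alpha>))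
        = step t m powr (- \<alpha>) / Gamma (2 - \<alpha>)"
      using step_pos[OF m] by (simp add: powr_diff powr_minus divide_inverse)
    then have "\<nu> * (step t m powr (- \<alpha>) / Gamma (2 - \<alpha>)) \<le> C m 0"
      using assms(7)[OF m order_refl] unfolding frac_int I by simp
    moreover have "lam < \<nu> * (step t m powr (- \<alpha>) / Gamma (2 - \<alpha>))"
      using assms(11)[OF m] step_pos[OF m] pos_less_divide_eq[of "step t m powr \<alpha>" lam "\<nu> / Gamma (2 - \<alpha>)"]
      by (simp add: powr_minus divide_inverse mult_ac)
    ultimately show "lam < C m 0" by simp
    have "discrete_deriv C e m = discrete_deriv C y m - A * discrete_deriv C v m"
      by (simp add: discrete_deriv_def e_def sum_distrib_left algebra_simps flip: sum_subtractf)
    \<comment> \<open>Since \<open>A\<close> is nonnegative, multiplying \<open>v_ge\<close> by it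
      keeps the direction of the inequality.\<close>
    also have "\<dots> \<le> (lam * y m + c) - A * (lam * v m)"
      using assms(13)[OF m] mult_left_mono[OF v_ge[OF m], of A] assms(14) by (simp add: A_def)
    also have "\<dots> = lam * e m"
      using assms(10) by (simp add: e_def algebra_simps)
    finally show "discrete_deriv C e m \<le> lam * e m" .
  qed
  then show "y n \<le> (y 0 + c / lam) * mittag_leffler \<alpha> 1 (inverse \<mu> * lam * t n powr \<alpha>) - c / lam"
    by (simp add: e_def v_def A_def \<kappa>_def)
qed

end
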